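(* Let $\mathcal{V}$ be a finite vocabulary, let $s$ be a context, let $p_0(\cdot\mid s)$ be a probability distribution on $\mathcal{V}$ (the frozen model), and let $p_\theta(\cdot\mid s)$ be a strictly positive (softmax) probability distribution on $\mathcal{V}$ (the student). Let $T=T_{\mathrm{train}}>0$, an integer $k_{\mathrm{train}}\ge 1$ and a threshold $\text{top-}p_{\mathrm{train}}\in(0,1]$ be training-time decoding parameters, let $S_s\subseteq\mathcal{V}$ be the retained support and $q_s$ the target distribution on $S_s$ that they induce from $p_0(\cdot\mid s)$ (see context). Let $\mathrm{KeptMass}_\theta(s)=\sum_{v\in S_s}p_\theta(v\mid s)$ and $p_\theta(v\mid s,S_s)=p_\theta(v\mid s)\mathbf{1}\{v\in S_s\}/\mathrm{KeptMass}_\theta(s)$. Then the per-context cross-entropy loss $$\mathcal{L}_s(\theta)=\mathbb{E}_{v\sim q_s}\bigl[-\log p_\theta(v\mid s)\bigr]$$ satisfies $$\mathcal{L}_s(\theta)=-\log \mathrm{KeptMass}_\theta(s)+(1-T)\,H_{1/T}\bigl(p_\theta(\cdot\mid s,S_s)\bigr)+T\cdot\mathrm{KL}\Bigl(q_s\,\Big\|\,\mathrm{Temper}^{S_s}_T[p_\theta(\cdot\mid s,S_s)]\Bigr)+T\cdot H(q_s).$$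
   Context: Tempering: for $T>0$, nonempty $S\subseteq\mathcal{V}$ and a distribution $p$ on $\mathcal{V}$ with $p(S)>0$, $\mathrm{Temper}_T^S[p](v)=\dfrac{p(v)^{1/T}\mathbf{1}\{v\in S\}}{\sum_{u\in S}p(u)^{1/T}}$, and $\mathrm{Temper}_T[p]=\mathrm{Temper}_T^{\mathcal{V}}[p]$. Truncation: for a distribution $\pi$ on $\mathcal{V}$, $\mathrm{TopK}(\pi,k)$ is the set of the $k$ tokens of largest $\pi$-probability (ties broken by a fixed deterministic rule). For $K\subseteq\mathcal{V}$ with $\pi(K)>0$, $\pi(\cdot\mid K)$ is $\pi$ conditioned on $K$, and $\mathrm{TopP}(\pi|_K,\text{top-}p)$ is the smallest prefix of the ranking of $K$ by decreasing $\pi(\cdot\mid K)$-mass whose cumulative $\pi(\cdot\mid K)$-mass is at least $\text{top-}p$. Retained support: with $\pi=\mathrm{Temper}_{T_{\mathrm{train}}}[p_0(\cdot\mid s)]$, $S_s=\mathrm{TopP}\bigl(\pi|_{\mathrm{TopK}(\pi,k_{\mathrm{train}})},\text{top-}p_{\mathrm{train}}\bigr)$. Target: $q_s(v)=\dfrac{p_0(v\mid s)^{1/T_{\mathrm{train}}}\mathbf{1}\{v\in S_s\}}{\sum_{u\in S_s}p_0(u\mid s)^{1/T_{\mathrm{train}}}}$. Entropies: $H$ is Shannon entropy; $H_\alpha(\pi)=\frac{1}{1-\alpha}\log\sum_v\pi(v)^\alpha$ is Rényi entropy of order $\alpha\ne1$ (sum over the set on which $\pi$ lives). The expression $(1-T)H_{1/T}(\pi)$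 is understood as $-T\log\sum_v\pi(v)^{1/T}$, which is $0$ at $T=1$. $\mathrm{KL}$ is the Kullback–Leibler divergence; here both of its arguments are supported on $S_s$. *)

theory Defs
  imports "HOL-Probability.Probability"
begin

text \<open>The vocabulary is a finite type \<open>'v\<close>; distributions on it are values of type \<open>'v pmf\<close>.
  Logarithms are natural.\<close>

section \<open>Tempering\<close>

definition temper :: "real \<Rightarrow> 'v::finite set \<Rightarrow> 'v pmf \<Rightarrow> 'v pmf" where
  "temper T S p =
     embed_pmf (\<lambda>v. pmf p v powr (1 / T) * indicator S v / (\<Sum>u\<in>S. pmf p u powr (1 / T)))"

text \<open>\<open>embed_pmf\<close> is only specified on genuine mass functions; this is one whenever \<open>p(S) > 0\<close>.\<close>

lemma pmf_temper:
  fixes p :: "'v::finite pmf"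
  assumes "measure_pmf.prob p S > 0"
  shows "pmf (temper T S p) v =
    pmf p v powr (1 / T) * indicator S v / (\<Sum>u\<in>S. pmf p u powr (1 / T))"
proof -
  let ?Z = "\<Sum>u\<in>S. pmf p u powr (1 / T)"
  let ?f = "\<lambda>v. pmf p v powr (1 / T) * indicator S v / ?Z"
  have "\<exists>u\<in>S. pmf p u \<noteq> 0"
  proof (rule ccontr)
    assume "\<not> ?thesis"
    then have "measure_pmf.prob p S = 0"
      by (simp add: measure_measure_pmf_finite)
    with assms show False by simp
  qed
  then obtain u where "u \<in> S" "pmf p u \<noteq> 0" by blast
  then have Z: "?Z > 0"
    by (intro sum_pos2[of S u]) auto
  have "(\<Sum>v\<in>UNIV. ?f v) = (\<Sum>v\<in>S. pmf p v powr (1 / T)) / ?Z"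
    by (simp add: sum_divide_distrib[symmetric] indicator_def if_distrib sum.If_cases)
  then have "(\<Sum>v\<in>UNIV. ?f v) = 1"
    using Z by simp
  then have "(\<integral>\<^sup>+v. ennreal (?f v) \<partial>count_space UNIV) = 1"
    using Z by (subst nn_integral_count_space_finite) (auto simp: sum_ennreal)
  then show ?thesis
    unfolding temper_def using Z by (subst pmf_embed_pmf) auto
qed


section \<open>Truncation\<close>

text \<open>A deterministic tie-breaking rule is modelled by a ranking function \<open>rk\<close>: \<open>rk p K\<close> lists the
  elements of \<open>K\<close> by decreasing \<open>p\<close>-mass, and tokens of equal mass come in whatever order \<open>rk\<close> has
  chosen. Breaking ties by a fixed linear order on the vocabulary is an instance.\<close>

definition ranking_rule :: "('v::finite pmf \<Rightarrow> 'v set \<Rightarrow> 'v list) \<Rightarrow> bool" where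
  "ranking_rule rk \<longleftrightarrow>
     (\<forall>p K. set (rk p K) = K \<and> distinct (rk p K) \<and>
            sorted_wrt (\<lambda>u v. pmf p u \<ge> pmf p v) (rk p K))"

lemma ranking_rule_linorder:
  "ranking_rule (\<lambda>(p :: 'v::{finite,linorder} pmf) K.
     sort_key (\<lambda>v. - pmf p v) (sorted_list_of_set K))"
proof -
  have "sorted_wrt (\<lambda>u v. pmf p u \<ge> pmf p v) (sort_key (\<lambda>v. - pmf p v) xs)"
    for p :: "'v pmf" and xs
    using sorted_sort_key[of "\<lambda>v. - pmf p v" xs] by (simp add: sorted_map)
  then show ?thesis
    by (simp add: ranking_rule_def)
qed

definition top_k :: "('v::finite pmf \<Rightarrow> 'v set \<Rightarrow> 'v list) \<Rightarrow> 'v pmf \<Rightarrow> nat \<Rightarrow> 'v set" where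
  "top_k rk \<pi> k = set (take k (rk \<pi> UNIV))"

definition top_p ::
  "('v::finite pmf \<Rightarrow> 'v set \<Rightarrow> 'v list) \<Rightarrow> 'v pmf \<Rightarrow> 'v set \<Rightarrow> real \<Rightarrow> 'v set" where
  "top_p rk \<pi> K c =
     (let \<pi>K = cond_pmf \<pi> K;
          r = rk \<pi>K K;
          n = (LEAST n. measure_pmf.prob \<pi>K (set (take n r)) \<ge> c)
      in set (take n r))"

definition retained_support ::
  "('v::finite pmf \<Rightarrow> 'v set \<Rightarrow> 'v list) \<Rightarrow> real \<Rightarrow> nat \<Rightarrow> real \<Rightarrow> 'v pmf \<Rightarrow> 'v set" where
  "retained_support rk T k c p =
     (let \<pi> = temper T UNIV p in top_p rk \<pi> (top_k rk \<pi> k) c)"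

definition target ::
  "('v::finite pmf \<Rightarrow> 'v set \<Rightarrow> 'v list) \<Rightarrow> real \<Rightarrow> nat \<Rightarrow> real \<Rightarrow> 'v pmf \<Rightarrow> 'v pmf" where
  "target rk T k c p = temper T (retained_support rk T k c p) p"


section \<open>Entropies, divergence and loss\<close>

definition shannon_entropy :: "'v pmf \<Rightarrow> real" where
  "shannon_entropy q = prob_space.entropy (measure_pmf q) (exp 1) (count_space UNIV) (\<lambda>v. v)"

lemma shannon_entropy_eq_sum:
  fixes q :: "'v::finite pmf"
  shows "shannon_entropy q = - (\<Sum>v\<in>UNIV. pmf q v * ln (pmf q v))"
proof -
  interpret information_space "measure_pmf q" "exp 1"
    by standard simp
  have "distributed (measure_pmf q) (count_space UNIV) (\<lambda>v. v) (\<lambda>v. ennreal (pmf q v))"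
    unfolding distributed_def
    using measure_pmf_eq_density[of q]
    by (auto simp: distr_id2 sets_measure_pmf_count_space)
  then have "prob_space.entropy (measure_pmf q) (exp 1) (count_space UNIV) (\<lambda>v. v) =
      - (\<integral>v. pmf q v * log (exp 1) (pmf q v) \<partial>count_space UNIV)"
    by (rule entropy_distr) simp
  then show ?thesis
    by (simp add: shannon_entropy_def lebesgue_integral_count_space_finite log_def)
qed

definition renyi_entropy :: "real \<Rightarrow> 'v pmf \<Rightarrow> real" where
  "renyi_entropy \<alpha> p = 1 / (1 - \<alpha>) * ln (\<Sum>v\<in>set_pmf p. pmf p v powr \<alpha>)"

text \<open>At \<open>T = 1\<close>, division by zero makes \<open>renyi_entropy 1 p = 0\<close>, and the factor \<open>1 - T\<close> vanishes, so
  \<open>(1 - T) * renyi_entropy (1 / T) p\<close> is the intended quantity for every \<open>T > 0\<close>.\<close>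

lemma renyi_entropy_term:
  fixes p :: "'v::finite pmf"
  assumes "T > 0"
  shows "(1 - T) * renyi_entropy (1 / T) p = - T * ln (\<Sum>v\<in>set_pmf p. pmf p v powr (1 / T))"
proof (cases "T = 1")
  case True
  have "(\<Sum>v\<in>set_pmf p. pmf p v powr 1) = 1"
    using sum_pmf_eq_1[of "set_pmf p" p] by simp
  with True show ?thesis by simp
next
  case False
  with assms have "(1 - T) * (1 / (1 - 1 / T)) = - T"
    by (simp add: field_simps)
  then show ?thesis
    unfolding renyi_entropy_def mult.assoc[symmetric] by simp
qed

text \<open>The library's \<open>KL_divergence b M N\<close> is the divergence of \<open>N\<close> from \<open>M\<close>, hence the swap.\<close>

definition KL :: "'v pmf \<Rightarrow> 'v pmf \<Rightarrow> real" where
  "KL q r = KL_divergence (exp 1) (measure_pmf r) (measure_pmf q)"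

lemma KL_eq_sum:
  fixes q r :: "'v::finite pmf"
  assumes "set_pmf q \<subseteq> set_pmf r"
  shows "KL q r = (\<Sum>v\<in>UNIV. pmf q v * ln (pmf q v / pmf r v))"
proof -
  interpret sigma_finite_measure "count_space (UNIV :: 'v set)"
    by (rule sigma_finite_measure_count_space_finite) simp
  have "KL_divergence (exp 1) (density (count_space UNIV) (\<lambda>v. ennreal (pmf r v)))
          (density (count_space UNIV) (\<lambda>v. ennreal (pmf q v))) =
        (\<integral>v. pmf q v * log (exp 1) (pmf q v / pmf r v) \<partial>count_space UNIV)"
    using assms by (intro KL_density_density) (auto simp: AE_count_space set_pmf_iff)
  then show ?thesis
    by (simp add: KL_def measure_pmf_eq_density[symmetric] log_def
        lebesgue_integral_count_space_finite)
qed

definition kept_mass :: "'v pmf \<Rightarrow> 'v::finite set \<Rightarrow> real" where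
  "kept_mass p S = (\<Sum>v\<in>S. pmf p v)"

definition cross_entropy_loss :: "'v pmf \<Rightarrow> 'v pmf \<Rightarrow> real" where
  "cross_entropy_loss q p = measure_pmf.expectation q (\<lambda>v. - ln (pmf p v))"

end

(* Since S meets the support of p_0, q_s lives on S. On S the tempered renormalised student is
   p(v)^(1/T) / (M^(1/T) Z), with M the kept mass and Z the sum of the (1/T)-th powers of p(. | S), so
   - T ln of it is - ln p(v) + ln M + T ln Z; average over q_s. *)

theory Submission
  imports Defs
begin

lemma prob_pos_iff_set_pmf: "measure_pmf.prob p A > 0 \<longleftrightarrow> set_pmf p \<inter> A \<noteq> {}"
  by (simp add: zero_less_measure_iff measure_pmf_zero_iff)

text \<open>\<open>x powr a\<close> vanishes exactly when \<open>x\<close> does, so tempering keeps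
  every zero and every nonzero mass on \<open>S\<close>. The hypothesis makes the normalising sum
  positive, hence \<open>embed_pmf\<close> meaningful.\<close>

lemma set_pmf_temper:
  fixes p :: "'v::finite pmf"
  assumes "set_pmf p \<inter> S \<noteq> {}"
  shows "set_pmf (temper T S p) = set_pmf p \<inter> S"
proof -
  obtain u where u: "u \<in> S" "pmf p u \<noteq> 0"
    using assms by (auto simp: set_pmf_iff)
  have "(\<Sum>u\<in>S. pmf p u powr (1 / T)) > 0"
    using u by (intro sum_pos2[of S u]) auto
  moreover have "measure_pmf.prob p S > 0"
    using assms by (simp add: prob_pos_iff_set_pmf)
  ultimately show ?thesis
    by (auto simp: set_pmf_iff pmf_temper indicator_def split: if_splits)
qed

text \<open>The head of the ranking maximises the mass, which is therefore positive there, and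
  \<open>k \<ge> 1\<close> keeps the head.\<close>

lemma set_pmf_inter_top_k:
  fixes \<pi> :: "'v::finite pmf"
  assumes "ranking_rule rk" "k \<ge> 1"
  shows "set_pmf \<pi> \<inter> top_k rk \<pi> k \<noteq> {}"
proof -
  have r: "set (rk \<pi> UNIV) = UNIV" "sorted_wrt (\<lambda>u v. pmf \<pi> u \<ge> pmf \<pi> v) (rk \<pi> UNIV)"
    using assms(1) by (auto simp: ranking_rule_def)
  obtain x xs where x: "rk \<pi> UNIV = x # xs"
    using r(1) by (cases "rk \<pi> UNIV") auto
  have max: "pmf \<pi> v \<le> pmf \<pi> x" for v
    using r unfolding x by (cases "v = x") auto
  obtain w where "w \<in> set_pmf \<pi>"
    using set_pmf_not_empty by fastforce
  then have "pmf \<pi> w > 0"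
    by (rule pmf_positive)
  with max[of w] have "x \<in> set_pmf \<pi>"
    by (simp add: set_pmf_iff)
  moreover have "x \<in> top_k rk \<pi> k"
    using assms(2) by (cases k) (auto simp: top_k_def x)
  ultimately show ?thesis by blast
qed

text \<open>The chosen prefix carries conditional mass at least \<open>c > 0\<close>, so it contains
  a token of positive mass.\<close>

lemma set_pmf_inter_top_p:
  fixes \<pi> :: "'v::finite pmf"
  assumes "ranking_rule rk" "set_pmf \<pi> \<inter> K \<noteq> {}" "0 < c" "c \<le> 1"
  shows "set_pmf \<pi> \<inter> top_p rk \<pi> K c \<noteq> {}"
proof -
  define \<pi>K where "\<pi>K = cond_pmf \<pi> K"
  define r where "r = rk \<pi>K K"
  define n where "n = (LEAST n. measure_pmf.prob \<pi>K (set (take n r)) \<ge> c)"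
  have supp: "set_pmf \<pi>K = set_pmf \<pi> \<inter> K"
    unfolding \<pi>K_def using assms(2) by (rule set_cond_pmf)
  have "set r = K"
    using assms(1) by (simp add: ranking_rule_def r_def)
  then have "measure_pmf.prob \<pi>K (set r) = 1"
    using supp by (simp add: measure_pmf.prob_eq_1 AE_measure_pmf_iff)
  \<comment> \<open>The whole ranking has mass 1, so \<open>c \<le> 1\<close> provides the witness
    that \<open>LEAST\<close> requires.\<close>
  then have "measure_pmf.prob \<pi>K (set (take (length r) r)) \<ge> c"
    using assms(4) by simp
  then have "measure_pmf.prob \<pi>K (set (take n r)) \<ge> c"
    unfolding n_def by (rule LeastI)
  then have "set_pmf \<pi>K \<inter> set (take n r) \<noteq> {}"
    using assms(3) by (simp flip: prob_pos_iff_set_pmf)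
  moreover have "top_p rk \<pi> K c = set (take n r)"
    by (simp add: top_p_def Let_def n_def r_def \<pi>K_def)
  ultimately show ?thesis
    using supp by auto
qed

text \<open>Truncation acts on the tempered model, but the target tempers \<open>p\<close> itself.
  Tempering over \<open>UNIV\<close> preserves the support, so a surviving token of the former also
  has positive mass under \<open>p\<close>.\<close>

lemma set_pmf_inter_retained_support:
  fixes p :: "'v::finite pmf"
  assumes "ranking_rule rk" "k \<ge> 1" "0 < c" "c \<le> 1"
  shows "set_pmf p \<inter> retained_support rk T k c p \<noteq> {}"
proof -
  have "set_pmf (temper T UNIV p) = set_pmf p"
    by (simp add: set_pmf_temper set_pmf_not_empty)
  then show ?thesis
    using set_pmf_inter_top_p[OF assms(1) set_pmf_inter_top_k[OF assms(1,2)] assms(3,4)]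
    by (metis retained_support_def)
qed

text \<open>The identity holds for any \<open>q\<close> living on \<open>S\<close>; truncation
  enters the theorem only through this inclusion.\<close>

lemma cross_entropy_loss_decomposition:
  fixes p q :: "'v::finite pmf"
  assumes pos: "\<And>v. v \<in> S \<Longrightarrow> pmf p v > 0"
    and supp: "set_pmf q \<subseteq> S"
    and T: "T > 0"
  shows "cross_entropy_loss q p =
      - ln (kept_mass p S)
      + (1 - T) * renyi_entropy (1 / T) (cond_pmf p S)
      + T * KL q (temper T S (cond_pmf p S))
      + T * shannon_entropy q"
proof -
  define c where "c = cond_pmf p S"
  define r where "r = temper T S c"
  define M where "M = kept_mass p S"
  define Z where "Z = (\<Sum>v\<in>S. pmf c v powr (1 / T))"
  have "S \<noteq> {}"
    using supp set_pmf_not_empty[of q] by blast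
  have sub: "S \<subseteq> set_pmf p"
    using pos by (fastforce simp: set_pmf_iff)
  then have ne: "set_pmf p \<inter> S \<noteq> {}"
    using \<open>S \<noteq> {}\<close> by blast
  have M: "M > 0" "measure_pmf.prob p S = M"
    using \<open>S \<noteq> {}\<close> pos by (auto simp: M_def kept_mass_def measure_measure_pmf_finite intro: sum_pos)
  \<comment> \<open>Positivity on \<open>S\<close> gives the conditional law all of \<open>S\<close>
    as support, so the sum inside \<open>renyi_entropy\<close> runs over \<open>S\<close> and equals
    \<open>Z\<close>.\<close>
  have set_c: "set_pmf c = S"
    using set_cond_pmf[OF ne] sub by (auto simp: c_def)
  have c: "pmf c v = pmf p v / M" if "v \<in> S" for v
    using that by (simp add: c_def pmf_cond[OF ne] M(2))
  have c_pos: "pmf c v > 0" if "v \<in> S" for v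
    using that set_c by (simp add: pmf_positive)
  have Z: "Z > 0"
    unfolding Z_def using \<open>S \<noteq> {}\<close> c_pos by (intro sum_pos) (auto simp: less_le)
  have prob_c: "measure_pmf.prob c S > 0"
    using \<open>S \<noteq> {}\<close> by (simp add: prob_pos_iff_set_pmf set_c)
  have set_r: "set_pmf r = S"
    using \<open>S \<noteq> {}\<close> by (simp add: r_def set_pmf_temper set_c)
  have ln_r: "- T * ln (pmf r v) = - ln (pmf p v) + ln M + T * ln Z" if "v \<in> S" for v
  proof -
    have "pmf r v = pmf c v powr (1 / T) / Z"
      using that by (simp add: r_def pmf_temper[OF prob_c] Z_def)
    then have "ln (pmf r v) = ln (pmf c v) / T - ln Z"
      using c_pos[OF that] Z by (simp add: ln_div ln_powr)
    moreover have "ln (pmf c v) = ln (pmf p v) - ln M"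
      using pos[OF that] M(1) by (simp add: c[OF that] ln_div)
    ultimately show ?thesis
      using T by (simp add: field_simps)
  qed
  \<comment> \<open>On the support of \<open>q\<close> both masses are positive and the logarithm
    splits; elsewhere the factor \<open>pmf q v\<close> makes both sides 0.\<close>
  have "pmf q v * ln (pmf q v / pmf r v) = pmf q v * ln (pmf q v) - pmf q v * ln (pmf r v)" for v
  proof (cases "v \<in> set_pmf q")
    case True
    then have "pmf q v > 0" "pmf r v > 0"
      using supp set_r by (auto simp: pmf_positive)
    then show ?thesis
      by (simp add: ln_div algebra_simps)
  qed (simp add: set_pmf_iff)
  \<comment> \<open>The terms \<open>q ln q\<close> cancel, leaving the cross-entropy of
    \<open>q\<close> relative to \<open>r\<close>. The sum form of \<open>KL\<close> applies because
    the support of \<open>q\<close> lies in that of \<open>r\<close>.\<close>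
  then have "KL q r + shannon_entropy q = (\<Sum>v\<in>UNIV. - (pmf q v * ln (pmf r v)))"
    using supp set_r by (simp add: KL_eq_sum shannon_entropy_eq_sum sum_subtractf sum_negf)
  then have "T * KL q r + T * shannon_entropy q = (\<Sum>v\<in>UNIV. pmf q v * (- T * ln (pmf r v)))"
    by (simp add: sum_distrib_left mult.left_commute flip: distrib_left)
  also have "\<dots> = (\<Sum>v\<in>UNIV. pmf q v * (- ln (pmf p v) + (ln M + T * ln Z)))"
  proof (rule sum.cong[OF refl])
    fix v show "pmf q v * (- T * ln (pmf r v)) = pmf q v * (- ln (pmf p v) + (ln M + T * ln Z))"
    \<comment> \<open>\<open>ln_r\<close> is available on \<open>S\<close> only; off the support of
      \<open>q\<close> the weight is 0.\<close>
    proof (cases "v \<in> set_pmf q")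
      case True
      with supp have "v \<in> S" by blast
      from ln_r[OF this] show ?thesis by (simp only: add.assoc)
    qed (simp add: set_pmf_iff)
  qed
  \<comment> \<open>The part independent of \<open>v\<close> comes out because the masses of
    \<open>q\<close> sum to 1.\<close>
  also have "\<dots> = (\<Sum>v\<in>UNIV. pmf q v * - ln (pmf p v)) + (ln M + T * ln Z)"
    unfolding distrib_left sum.distrib
    by (simp add: sum_pmf_eq_1 flip: sum_distrib_right distrib_left)
  also have "(\<Sum>v\<in>UNIV. pmf q v * - ln (pmf p v)) = cross_entropy_loss q p"
    unfolding cross_entropy_loss_def
    by (subst integral_measure_pmf_real[of UNIV]) (auto simp: mult.commute)
  finally have "T * KL q r + T * shannon_entropy q = cross_entropy_loss q p + (ln M + T * ln Z)" .
  moreover have "(1 - T) * renyi_entropy (1 / T) c = - T * ln Z"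
    by (simp only: renyi_entropy_term[OF T] set_c Z_def)
  ultimately show ?thesis
    by (simp add: M_def flip: c_def r_def)
qed

theorem mainTheorem1:
  fixes p0 :: "'c \<Rightarrow> 'v::finite pmf"
    and p :: "'\<theta> \<Rightarrow> 'c \<Rightarrow> 'v pmf"
    and rk :: "'v pmf \<Rightarrow> 'v set \<Rightarrow> 'v list"
    and T top_p_train :: real
    and k_train :: nat
    and s :: 'c
    and \<theta> :: '\<theta>
    and S :: "'v set"
    and q :: "'v pmf"
  assumes student_pos: "\<And>v. pmf (p \<theta> s) v > 0"
    and rk: "ranking_rule rk"
    and T: "T > 0"
    and k: "k_train \<ge> 1"
    and top_p: "0 < top_p_train" "top_p_train \<le> 1"
    and S: "S = retained_support rk T k_train top_p_train (p0 s)"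
    and q: "q = target rk T k_train top_p_train (p0 s)"
  shows "cross_entropy_loss q (p \<theta> s) =
      - ln (kept_mass (p \<theta> s) S)
      + (1 - T) * renyi_entropy (1 / T) (cond_pmf (p \<theta> s) S)
      + T * KL q (temper T S (cond_pmf (p \<theta> s) S))
      + T * shannon_entropy q"
proof -
  \<comment> \<open>If \<open>S\<close> had no mass under \<open>p0 s\<close>, the value of
    \<open>temper\<close>, and with it \<open>q\<close>, would be unspecified.\<close>
  have "set_pmf (p0 s) \<inter> S \<noteq> {}"
    unfolding S using rk k top_p by (rule set_pmf_inter_retained_support)
  then have "set_pmf q \<subseteq> S"
    unfolding q target_def S[symmetric] by (simp add: set_pmf_temper)
  with student_pos T show ?thesis
    by (intro cross_entropy_loss_decomposition)
qed

end
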